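(* Let $b\ge2$ and let $N$ be a positive integer. Then $\exp(X_{b,N}(x))=S_{b,N}(x)$.
   Context: Rows and columns are indexed from $0$; $\otimes$ is the Kronecker product, $I_m$ the $m\times m$ identity matrix, and $\exp$ the matrix exponential. $X_{b,1}(x)$ is the $b\times b$ strictly lower-triangular matrix whose $(j,k)$-entry is $x/(j-k)$ if $j\ge k+1$ and $0$ otherwise; for $N\ge1$, $X_{b,N+1}(x)=X_{b,1}(x)\otimes I_{b^N}+I_b\otimes X_{b,N}(x)$ (the Kronecker sum). $S_{b,1}(x)$ is the $b\times b$ lower-triangular matrix whose $(j,k)$-entry is $\binom{x+j-k-1}{j-k}$ if $0\le k\le j\le b-1$ and $0$ otherwise, where $\binom{z}{d}=z(z-1)\cdots(z-d+1)/d!$; for $N\ge1$, $S_{b,N+1}(x)=S_{b,1}(x)\otimes S_{b,N}(x)$. *)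

theory Defs
  imports Complex_Main "Jordan_Normal_Form.Matrix"
begin

definition kron :: "'a::semiring_1 mat \<Rightarrow> 'a mat \<Rightarrow> 'a mat" (infixl "\<otimes>\<^sub>k" 72) where
  "A \<otimes>\<^sub>k B = mat (dim_row A * dim_row B) (dim_col A * dim_col B)
     (\<lambda>(i, j). A $$ (i div dim_row B, j div dim_col B) * B $$ (i mod dim_row B, j mod dim_col B))"

text \<open>The type of matrices carries no topology, so the exponential series is summed entry by
  entry, which for matrices of a fixed finite size is the same as convergence in any norm.
  The definition is meant for square matrices only.\<close>

definition mat_exp :: "'a::{real_normed_field, banach} mat \<Rightarrow> 'a mat" where
  "mat_exp A = mat (dim_row A) (dim_col A) (\<lambda>(i, j). \<Sum>n. (A ^\<^sub>m n) $$ (i, j) / fact n)"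

text \<open>The series converges for every square matrix, so the value of \<^const>\<open>suminf\<close> is never
  the arbitrary one.\<close>

lemma norm_pow_mat_entry_le:
  fixes A :: "'a::{real_normed_field, banach} mat"
  assumes A: "A \<in> carrier_mat m m"
    and C: "\<And>i j. i < m \<Longrightarrow> j < m \<Longrightarrow> norm (A $$ (i, j)) \<le> C"
    and ij: "i < m" "j < m"
  shows "norm ((A ^\<^sub>m n) $$ (i, j)) \<le> (real m * C) ^ n"
  using ij
proof (induction n arbitrary: i j)
  case 0
  then show ?case using A by (auto simp: one_mat_def)
next
  case (Suc n)
  have C0: "C \<ge> 0" using C[OF Suc.prems] norm_ge_zero order_trans by blast
  have P: "A ^\<^sub>m n \<in> carrier_mat m m" using A by (rule pow_carrier_mat)
  have "(A ^\<^sub>m Suc n) $$ (i, j) = (\<Sum>l<m. (A ^\<^sub>m n) $$ (i, l) * A $$ (l, j))"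
    using A P Suc.prems by (simp add: scalar_prod_def atLeast0LessThan)
  also have "norm \<dots> \<le> (\<Sum>l<m. norm ((A ^\<^sub>m n) $$ (i, l)) * norm (A $$ (l, j)))"
    by (rule order_trans[OF norm_sum]) (simp add: norm_mult)
  also have "\<dots> \<le> (\<Sum>l<m. (real m * C) ^ n * C)"
    using Suc C C0 by (intro sum_mono mult_mono) auto
  also have "\<dots> = (real m * C) ^ Suc n"
    by (simp add: algebra_simps)
  finally show ?case .
qed

lemma summable_mat_exp:
  fixes A :: "'a::{real_normed_field, banach} mat"
  assumes A: "A \<in> carrier_mat m m" and ij: "i < m" "j < m"
  shows "summable (\<lambda>n. (A ^\<^sub>m n) $$ (i, j) / fact n)"
proof -
  define C where "C = (\<Sum>p\<in>{..<m} \<times> {..<m}. norm (A $$ p))"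
  have C: "norm (A $$ (k, l)) \<le> C" if "k < m" "l < m" for k l
    unfolding C_def using that by (intro member_le_sum) auto
  have "summable (\<lambda>n. inverse (fact n) * (real m * C) ^ n)"
    by (rule summable_exp)
  then show ?thesis
  proof (rule summable_comparison_test')
    fix n :: nat
    show "norm ((A ^\<^sub>m n) $$ (i, j) / fact n) \<le> inverse (fact n) * (real m * C) ^ n"
      using norm_pow_mat_entry_le[OF A C ij, of n]
      by (simp add: norm_divide divide_inverse_commute[symmetric] divide_right_mono)
  qed
qed

definition X1 :: "nat \<Rightarrow> 'a::real_normed_field \<Rightarrow> 'a mat" where
  "X1 b x = mat b b (\<lambda>(j, k). if j \<ge> k + 1 then x / of_nat (j - k) else 0)"

definition S1 :: "nat \<Rightarrow> 'a::real_normed_field \<Rightarrow> 'a mat" where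
  "S1 b x = mat b b (\<lambda>(j, k). if k \<le> j
     then (x + of_nat j - of_nat k - 1) gchoose (j - k) else 0)"

text \<open>Both families are meant for indices \<open>N \<ge> 1\<close>; the equations at \<open>0\<close> only make the
  functions total and are not used by the recursion.\<close>

fun X_mat :: "nat \<Rightarrow> nat \<Rightarrow> 'a::real_normed_field \<Rightarrow> 'a mat" where
  "X_mat b 0 x = 0\<^sub>m 1 1"
| "X_mat b (Suc 0) x = X1 b x"
| "X_mat b (Suc (Suc N)) x = X1 b x \<otimes>\<^sub>k 1\<^sub>m (b ^ Suc N) + 1\<^sub>m b \<otimes>\<^sub>k X_mat b (Suc N) x"

fun S_mat :: "nat \<Rightarrow> nat \<Rightarrow> 'a::real_normed_field \<Rightarrow> 'a mat" where
  "S_mat b 0 x = 1\<^sub>m 1"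
| "S_mat b (Suc 0) x = S1 b x"
| "S_mat b (Suc (Suc N)) x = S1 b x \<otimes>\<^sub>k S_mat b (Suc N) x"

end

theory Submission
  imports Defs "HOL-Computational_Algebra.Formal_Power_Series"
begin

text \<open>Strictly lower-triangular Toeplitz matrices represent formal power series without constant
  term, and \<open>X_{b,1}(x)\<close> represents \<open>-x log(1 - z)\<close>; its exponential therefore represents
  \<open>(1 - z)^{-x}\<close>, whose coefficients are the entries of \<open>S_{b,1}(x)\<close>. The general case follows from
  \<open>exp(A \<otimes> I + I \<otimes> B) = exp A \<otimes> exp B\<close>, which is a Cauchy product of the two
  exponential series.\<close>

text \<open>The matrix of multiplication by \<open>f\<close> on power series modulo z^b, in the
  basis 1, z, ..., z^(b-1).\<close>

definition toeplitz :: "nat \<Rightarrow> 'a::zero fps \<Rightarrow> 'a mat" where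
  "toeplitz b f = mat b b (\<lambda>(j, k). if k \<le> j then fps_nth f (j - k) else 0)"

lemma toeplitz_carrier [simp]: "toeplitz b f \<in> carrier_mat b b"
  by (simp add: toeplitz_def)

lemma toeplitz_index:
  "j < b \<Longrightarrow> k < b \<Longrightarrow> toeplitz b f $$ (j, k) = (if k \<le> j then fps_nth f (j - k) else 0)"
  by (simp add: toeplitz_def)

text \<open>Triangularity leaves only the indices \<open>l\<close> between \<open>k\<close> and
  \<open>j\<close>, and reindexing by \<open>i = j - l\<close> turns the matrix product into the
  Cauchy product of coefficients.\<close>

lemma toeplitz_mult:
  fixes f g :: "'a::comm_semiring_1 fps"
  shows "toeplitz b f * toeplitz b g = toeplitz b (f * g)"
proof (rule eq_matI)
  fix j k assume "j < dim_row (toeplitz b (f * g))" "k < dim_col (toeplitz b (f * g))"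
  then have jk: "j < b" "k < b" by (auto simp: toeplitz_def)
  have "(toeplitz b f * toeplitz b g) $$ (j, k)
      = (\<Sum>l<b. toeplitz b f $$ (j, l) * toeplitz b g $$ (l, k))"
    using jk by (simp add: toeplitz_def scalar_prod_def atLeast0LessThan)
  also have "\<dots> = (\<Sum>l\<in>{k..j}. fps_nth f (j - l) * fps_nth g (l - k))"
    using jk by (intro sum.mono_neutral_cong_right) (auto simp: toeplitz_index)
  also have "\<dots> = toeplitz b (f * g) $$ (j, k)"
  proof (cases "k \<le> j")
    case True
    have "(\<Sum>l\<in>{k..j}. fps_nth f (j - l) * fps_nth g (l - k))
        = (\<Sum>i=0..j - k. fps_nth f i * fps_nth g (j - k - i))"
      using True by (intro sum.reindex_bij_witness[of _ "\<lambda>i. j - i" "\<lambda>l. j - l"]) auto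
    then show ?thesis using True jk by (simp add: toeplitz_index fps_mult_nth)
  qed (use jk in \<open>simp add: toeplitz_index\<close>)
  finally show "(toeplitz b f * toeplitz b g) $$ (j, k) = toeplitz b (f * g) $$ (j, k)" .
qed (auto simp: toeplitz_def)

lemma toeplitz_one: "toeplitz b (1 :: 'a::comm_semiring_1 fps) = 1\<^sub>m b"
  by (rule eq_matI) (auto simp: toeplitz_def)

lemma toeplitz_pow:
  fixes f :: "'a::comm_semiring_1 fps"
  shows "toeplitz b f ^\<^sub>m n = toeplitz b (f ^ n)"
proof (induction n)
  case 0
  then show ?case using toeplitz_carrier[of b f] by (simp add: toeplitz_one del: toeplitz_carrier)
next
  case (Suc n)
  then show ?case by (simp add: toeplitz_mult mult.commute)
qed

text \<open>Without a constant term, \<open>f ^ n\<close> begins in degree at least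
  \<open>n\<close>, so only \<open>n \<le> j - k\<close> contributes to an entry. The exponential
  series becomes the finite sum that defines a coefficient of the composition.\<close>

lemma mat_exp_toeplitz:
  fixes f :: "'a::{real_normed_field, banach} fps"
  assumes f0: "fps_nth f 0 = 0"
  shows "mat_exp (toeplitz b f) = toeplitz b (fps_exp 1 oo f)"
proof (rule eq_matI)
  fix j k assume "j < dim_row (toeplitz b (fps_exp 1 oo f))" "k < dim_col (toeplitz b (fps_exp 1 oo f))"
  then have jk: "j < b" "k < b" by (auto simp: toeplitz_def)
  have "mat_exp (toeplitz b f) $$ (j, k) = (\<Sum>n. toeplitz b (f ^ n) $$ (j, k) / fact n)"
    using jk by (simp add: mat_exp_def toeplitz_pow) (simp add: toeplitz_def)
  also have "\<dots> = toeplitz b (fps_exp 1 oo f) $$ (j, k)"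
  proof (cases "k \<le> j")
    case True
    have "(\<Sum>n. fps_nth (f ^ n) (j - k) / fact n)
        = (\<Sum>n\<in>{0..j - k}. fps_nth (f ^ n) (j - k) / fact n)"
    proof (rule suminf_finite)
      fix n assume "n \<notin> {0..j - k}"
      then show "fps_nth (f ^ n) (j - k) / fact n = 0"
        using startsby_zero_power_prefix[OF f0, of n] by auto
    qed simp
    then show ?thesis using True jk by (simp add: toeplitz_index fps_compose_nth)
  qed (use jk in \<open>simp add: toeplitz_index\<close>)
  finally show "mat_exp (toeplitz b f) $$ (j, k) = toeplitz b (fps_exp 1 oo f) $$ (j, k)" .
qed (auto simp: toeplitz_def mat_exp_def)

text \<open>The coefficients of (1 - z)^(-x) are read off from the differential equation E' = E L'
  with L' = x / (1 - z).\<close>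

lemma fps_exp_compose_log_nth:
  fixes x :: "'a::field_char_0"
  defines "L \<equiv> Abs_fps (\<lambda>d. x / of_nat d)"
  shows "fps_nth (fps_exp 1 oo L) d = (x + of_nat d - 1) gchoose d"
proof -
  define E where "E = fps_exp 1 oo L"
  \<comment> \<open>Division by zero yields 0, so the formula for \<open>L\<close> already gives the
    right constant term.\<close>
  have L0: "fps_nth L 0 = 0" by (simp add: L_def)
  have "fps_deriv E = E * fps_deriv L"
    unfolding E_def by (subst fps_compose_deriv[OF L0]) simp
  then have rec: "of_nat (Suc n) * fps_nth E (Suc n) = (\<Sum>i=0..n. fps_nth E i * x)" for n
    by (auto simp: fps_eq_iff fps_mult_nth L_def simp del: of_nat_Suc)
  \<comment> \<open>Subtracting \<open>rec\<close> at \<open>n - 1\<close> from \<open>rec\<close>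
    at \<open>n\<close> cancels the partial sums and leaves a one-term recurrence, that of the
    rising factorial over the factorial.\<close>
  have step: "of_nat (Suc n) * fps_nth E (Suc n) = (x + of_nat n) * fps_nth E n" for n
  proof (cases n)
    case (Suc m)
    show ?thesis using rec[of n] rec[of m] by (simp add: Suc algebra_simps)
  qed (use rec[of 0] in simp)
  have "fps_nth E n = pochhammer x n / fact n" for n
  proof (induction n)
    case 0
    show ?case by (simp add: E_def)
  next
    case (Suc n)
    have "fps_nth E (Suc n) = (x + of_nat n) * fps_nth E n / of_nat (Suc n)"
      using step[of n] by (simp add: field_simps del: of_nat_Suc)
    then show ?case by (simp add: Suc.IH pochhammer_Suc field_simps del: of_nat_Suc)
  qed
  \<comment> \<open>The upper argument \<open>x + of_nat d - 1\<close> is the one whose falling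
    factorial of length \<open>d\<close> is \<open>pochhammer x d\<close>.\<close>
  then show ?thesis by (simp add: E_def gbinomial_pochhammer' algebra_simps)
qed

lemma mat_exp_X1: "mat_exp (X1 b x) = S1 b (x :: 'a::{real_normed_field, banach})"
proof -
  let ?L = "Abs_fps (\<lambda>d. x / of_nat d)"
  \<comment> \<open>On the diagonal \<open>toeplitz\<close> reads \<open>x / of_nat 0\<close>, which
    is 0 as strict triangularity demands.\<close>
  have "X1 b x = toeplitz b ?L"
    by (rule eq_matI) (auto simp: X1_def toeplitz_def)
  moreover have "S1 b x = toeplitz b (fps_exp 1 oo ?L)"
    unfolding toeplitz_def fps_exp_compose_log_nth
    by (rule eq_matI) (auto simp: S1_def of_nat_diff algebra_simps)
  ultimately show ?thesis by (simp add: mat_exp_toeplitz)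
qed

lemma kron_carrier [simp]:
  "A \<in> carrier_mat m n \<Longrightarrow> B \<in> carrier_mat p q \<Longrightarrow> A \<otimes>\<^sub>k B \<in> carrier_mat (m * p) (n * q)"
  by (auto simp: kron_def)

text \<open>Splits a Kronecker index into its block \<open>s\<close> and its offset
  \<open>t\<close>, as decoded by \<open>div\<close> and \<open>mod\<close> in
  \<open>kron\<close>.\<close>

lemma sum_lessThan_mult:
  fixes f :: "nat \<Rightarrow> 'a::comm_monoid_add"
  shows "(\<Sum>l<p * q. f l) = (\<Sum>s<p. \<Sum>t<q. f (s * q + t))"
proof -
  have "(\<Sum>t<q. f (s * q + t)) = sum f {s * q..<s * q + q}" for s
    by (intro sum.reindex_bij_witness[of _ "\<lambda>l. l - s * q" "\<lambda>t. s * q + t"]) auto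
  then show ?thesis by (simp add: sum.nat_group)
qed

text \<open>The binomial theorem for the commuting summands, read entrywise; the factorials absorb
  the binomial coefficients. The induction peels a factor off on the right, so the column varies
  while the row stays fixed.\<close>

lemma kron_sum_pow_index:
  fixes A B :: "'a::field_char_0 mat"
  assumes A: "A \<in> carrier_mat p p" and B: "B \<in> carrier_mat q q"
    and ij: "i < p * q" "j < p * q"
  shows "((A \<otimes>\<^sub>k 1\<^sub>m q + 1\<^sub>m p \<otimes>\<^sub>k B) ^\<^sub>m n) $$ (i, j) / fact n
    = (\<Sum>k\<le>n. (A ^\<^sub>m k) $$ (i div q, j div q) / fact k
        * ((B ^\<^sub>m (n - k)) $$ (i mod q, j mod q) / fact (n - k)))"
  using ij
proof (induction n arbitrary: j)
  case 0
  have q: "q > 0" using 0 by (cases q) auto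
  have "i = j \<longleftrightarrow> i div q = j div q \<and> i mod q = j mod q" by (metis div_mult_mod_eq)
  moreover have "i div q < p" "j div q < p" using 0 by (auto simp: less_mult_imp_div_less)
  ultimately show ?case using 0 A B q by (auto simp: kron_def)
next
  case (Suc n)
  let ?M = "A \<otimes>\<^sub>k 1\<^sub>m q + 1\<^sub>m p \<otimes>\<^sub>k B"
  define a where "a k l = (A ^\<^sub>m k) $$ (i div q, l) / fact k" for k l
  define c where "c k l = (B ^\<^sub>m k) $$ (i mod q, l) / fact k" for k l
  define u where "u = j div q"
  define v where "v = j mod q"
  have q: "q > 0" using Suc.prems by (cases q) auto
  have uv: "i div q < p" "u < p" "i mod q < q" "v < q"
    using Suc.prems q by (auto simp: u_def v_def less_mult_imp_div_less)
  have M: "?M \<in> carrier_mat (p * q) (p * q)" using A B by auto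
  have Mn: "?M ^\<^sub>m n \<in> carrier_mat (p * q) (p * q)" using M by (rule pow_carrier_mat)
  have lt: "s * q + t < p * q" if "s < p" "t < q" for s t
    using that by (metis add.commute add_mult_distrib less_le_trans mult_le_mono1 nat_add_left_cancel_less
        plus_1_eq_Suc Suc_leI mult_1)
  have Mij: "?M $$ (s * q + t, j) = (if t = v then A $$ (s, u) else 0) + (if s = u then B $$ (t, v) else 0)"
    if "s < p" "t < q" for s t
    using lt[OF that] that Suc.prems A B uv by (auto simp: kron_def u_def v_def)
  have IH: "(?M ^\<^sub>m n) $$ (i, s * q + t) / fact n = (\<Sum>k\<le>n. a k s * c (n - k) t)"
    if "s < p" "t < q" for s t
    using Suc.IH[OF Suc.prems(1) lt[OF that]] that by (simp add: a_def c_def)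
  \<comment> \<open>One more factor \<open>A\<close> raises the power, and 1/k! = (k+1)/(k+1)!
    supplies the weight; likewise for \<open>B\<close> below.\<close>
  have arec: "(\<Sum>s<p. a k s * A $$ (s, u)) = of_nat (Suc k) * a (Suc k) u" for k
    using A uv pow_carrier_mat[OF A, of k]
    by (simp add: a_def scalar_prod_def atLeast0LessThan sum_divide_distrib sum_distrib_left del: of_nat_Suc)
  have crec: "(\<Sum>t<q. c k t * B $$ (t, v)) = of_nat (Suc k) * c (Suc k) v" for k
    using B uv pow_carrier_mat[OF B, of k]
    by (simp add: c_def scalar_prod_def atLeast0LessThan sum_divide_distrib sum_distrib_left del: of_nat_Suc)
  have "(?M ^\<^sub>m Suc n) $$ (i, j) / fact n
      = (\<Sum>l<p * q. (?M ^\<^sub>m n) $$ (i, l) / fact n * ?M $$ (l, j))"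
    using Mn M Suc.prems by (simp add: scalar_prod_def atLeast0LessThan sum_divide_distrib del: index_add_mat)
  also have "\<dots> = (\<Sum>s<p. \<Sum>t<q. (?M ^\<^sub>m n) $$ (i, s * q + t) / fact n * ?M $$ (s * q + t, j))"
    by (rule sum_lessThan_mult)
  also have "\<dots> = (\<Sum>s<p. \<Sum>t<q. (\<Sum>k\<le>n. a k s * c (n - k) t)
        * ((if t = v then A $$ (s, u) else 0) + (if s = u then B $$ (t, v) else 0)))"
    by (intro sum.cong refl) (simp only: IH Mij lessThan_iff)
  \<comment> \<open>Each identity factor is a Kronecker delta that collapses one of the two
    sums.\<close>
  also have "\<dots> = (\<Sum>s<p. (\<Sum>k\<le>n. a k s * c (n - k) v) * A $$ (s, u))
      + (\<Sum>t<q. (\<Sum>k\<le>n. a k u * c (n - k) t) * B $$ (t, v))"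
    using uv by (simp add: distrib_left sum.distrib if_distrib[of "\<lambda>x. _ * x"] sum.swap[of _ "{..<q}" "{..<p}"]
        cong: if_cong)
  also have "\<dots> = (\<Sum>k\<le>n. (\<Sum>s<p. a k s * A $$ (s, u)) * c (n - k) v)
      + (\<Sum>k\<le>n. a k u * (\<Sum>t<q. c (n - k) t * B $$ (t, v)))"
    by (simp add: sum_distrib_left sum_distrib_right mult_ac
        sum.swap[of _ "{..n}" "{..<p}"] sum.swap[of _ "{..n}" "{..<q}"])
  also have "\<dots> = (\<Sum>k\<le>n. of_nat (Suc k) * a (Suc k) u * c (n - k) v)
      + (\<Sum>k\<le>n. of_nat (Suc n - k) * (a k u * c (Suc n - k) v))"
    unfolding arec crec by (simp add: Suc_diff_le mult_ac del: of_nat_Suc)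
  \<comment> \<open>The first sum is shifted by one; the terms added, at \<open>k = 0\<close> in the
    first sum and \<open>k = Suc n\<close> in the second, have weight 0.\<close>
  also have "\<dots> = (\<Sum>k\<le>Suc n. of_nat k * (a k u * c (Suc n - k) v))
      + (\<Sum>k\<le>Suc n. of_nat (Suc n - k) * (a k u * c (Suc n - k) v))"
  proof (rule arg_cong2[of _ _ _ _ "(+)"])
    show "(\<Sum>k\<le>n. of_nat (Suc k) * a (Suc k) u * c (n - k) v)
        = (\<Sum>k\<le>Suc n. of_nat k * (a k u * c (Suc n - k) v))"
      by (subst sum.atMost_Suc_shift) (simp add: mult_ac del: of_nat_Suc)
  qed simp
  \<comment> \<open>The weights \<open>k\<close> and \<open>Suc n - k\<close> add up to
    \<open>Suc n\<close>, which turns \<open>fact n\<close> into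
    \<open>fact (Suc n)\<close>.\<close>
  also have "\<dots> = of_nat (Suc n) * (\<Sum>k\<le>Suc n. a k u * c (Suc n - k) v)"
    unfolding sum.distrib[symmetric] sum_distrib_left
    by (intro sum.cong refl) (simp add: distrib_right[symmetric] of_nat_add[symmetric] del: of_nat_Suc of_nat_add)
  finally have "(?M ^\<^sub>m Suc n) $$ (i, j) / fact (Suc n) = (\<Sum>k\<le>Suc n. a k u * c (Suc n - k) v)"
    by (simp add: field_simps del: of_nat_Suc sum.atMost_Suc pow_mat.simps)
  then show ?case by (simp only: a_def c_def u_def v_def)
qed

text \<open>The Cauchy product calls for absolute convergence; the majorant is again the exponential
  series of \<open>real m * C\<close>.\<close>

lemma summable_norm_mat_exp:
  fixes A :: "'a::{real_normed_field, banach} mat"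
  assumes A: "A \<in> carrier_mat m m" and ij: "i < m" "j < m"
  shows "summable (\<lambda>n. norm ((A ^\<^sub>m n) $$ (i, j) / fact n))"
proof -
  define C where "C = (\<Sum>p\<in>{..<m} \<times> {..<m}. norm (A $$ p))"
  have C: "norm (A $$ (k, l)) \<le> C" if "k < m" "l < m" for k l
    unfolding C_def using that by (intro member_le_sum) auto
  have "summable (\<lambda>n. inverse (fact n) * (real m * C) ^ n)"
    by (rule summable_exp)
  then show ?thesis
  proof (rule summable_comparison_test')
    fix n :: nat
    show "norm (norm ((A ^\<^sub>m n) $$ (i, j) / fact n)) \<le> inverse (fact n) * (real m * C) ^ n"
      using norm_pow_mat_entry_le[OF A C ij, of n]
      by (simp add: norm_divide divide_inverse_commute[symmetric] divide_right_mono)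
  qed
qed

lemma mat_exp_kron_sum:
  fixes A B :: "'a::{real_normed_field, banach} mat"
  assumes A: "A \<in> carrier_mat p p" and B: "B \<in> carrier_mat q q"
  shows "mat_exp (A \<otimes>\<^sub>k 1\<^sub>m q + 1\<^sub>m p \<otimes>\<^sub>k B) = mat_exp A \<otimes>\<^sub>k mat_exp B"
proof (rule eq_matI)
  let ?M = "A \<otimes>\<^sub>k 1\<^sub>m q + 1\<^sub>m p \<otimes>\<^sub>k B"
  have M: "?M \<in> carrier_mat (p * q) (p * q)" using A B by auto
  fix i j assume "i < dim_row (mat_exp A \<otimes>\<^sub>k mat_exp B)" "j < dim_col (mat_exp A \<otimes>\<^sub>k mat_exp B)"
  then have ij: "i < p * q" "j < p * q" using A B by (auto simp: kron_def mat_exp_def)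
  then have "q > 0" by (cases q) auto
  then have lt: "i div q < p" "j div q < p" "i mod q < q" "j mod q < q"
    using ij by (auto simp: less_mult_imp_div_less)
  have "mat_exp ?M $$ (i, j) = (\<Sum>n. (?M ^\<^sub>m n) $$ (i, j) / fact n)"
    using M ij by (simp add: mat_exp_def del: index_add_mat)
  also have "\<dots> = (\<Sum>n. \<Sum>k\<le>n. (A ^\<^sub>m k) $$ (i div q, j div q) / fact k
        * ((B ^\<^sub>m (n - k)) $$ (i mod q, j mod q) / fact (n - k)))"
    by (simp only: kron_sum_pow_index[OF A B ij])
  \<comment> \<open>The inner sums are the convolution of two absolutely convergent scalar series,
    so the whole factors.\<close>
  also have "\<dots> = (\<Sum>n. (A ^\<^sub>m n) $$ (i div q, j div q) / fact n)
        * (\<Sum>n. (B ^\<^sub>m n) $$ (i mod q, j mod q) / fact n)"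
    by (rule Cauchy_product[symmetric])
       (use summable_norm_mat_exp A B lt in blast)+
  also have "\<dots> = (mat_exp A \<otimes>\<^sub>k mat_exp B) $$ (i, j)"
    using A B ij lt by (simp add: kron_def mat_exp_def)
  finally show "mat_exp ?M $$ (i, j) = (mat_exp A \<otimes>\<^sub>k mat_exp B) $$ (i, j)" .
qed (use A B in \<open>auto simp: kron_def mat_exp_def\<close>)

lemma X1_carrier [simp]: "X1 b x \<in> carrier_mat b b"
  by (simp add: X1_def)

lemma X_mat_carrier: "X_mat b N x \<in> carrier_mat (b ^ N) (b ^ N)"
proof (induction b N x rule: X_mat.induct)
  case (3 b N x)
  have "1\<^sub>m b \<otimes>\<^sub>k X_mat b (Suc N) x \<in> carrier_mat (b * b ^ Suc N) (b * b ^ Suc N)"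
    using 3 by (intro kron_carrier) auto
  then show ?case by auto
qed auto

theorem theorem2p9:
  fixes b N :: nat and x :: "'a::{real_normed_field, banach}"
  assumes "b \<ge> 2" and "N \<ge> 1"
  shows "mat_exp (X_mat b N x) = S_mat b N x"
  using assms(2)
proof (induction N rule: dec_induct)
  case base
  then show ?case by (simp add: mat_exp_X1)
next
  case (step N)
  \<comment> \<open>Writing \<open>N\<close> as a successor exposes \<open>Suc (Suc N')\<close>, the
    form matched by the recursive equations of \<open>X_mat\<close> and
    \<open>S_mat\<close>.\<close>
  then obtain N' where N: "N = Suc N'" by (cases N) auto
  show ?case
    using step.IH mat_exp_kron_sum[OF X1_carrier X_mat_carrier, of b x b "Suc N'" x]
    by (simp add: N mat_exp_X1)
qed

end
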